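(* Let $s\ge2$ be an integer, $c_l>2$, $\rho_s>0$, and let $(\rho,U,W)$ be the constructed profile on $[0,\infty)$ with parameters $(s,c_l,\rho_s)$ (defined in the context). Suppose that $\lim_{\xi\to+\infty}U(\xi)/\xi=0$. Then: (i) (near field) $W(\xi)$, $U(\xi)$, $\rho(\xi)$ are analytic with respect to $\xi$ at $\xi=0$; (ii) (far field) $W(\xi)$, $U(\xi)\xi^{-1}$, $\rho(\xi)\xi^{-1}$, regarded as functions of $\theta=\xi^{-1/c_l}$, are analytic at $\theta=0$, i.e. for all sufficiently small $\theta>0$ each coincides with the sum of a power series in $\theta$ with positive radius of convergence.
   Context: Local system: for $\xi>0$, $(2-c_l)\rho+c_l\xi\rho'+U\rho'=0$, $\;W+c_l\xi W'+UW'-\rho'=0$, $\;(U/\xi)'=W/\xi$. Constructed profile with parameters $(s,c_l,\rho_s)$: the unique solution of the local system given near $\xi=0$ by convergent power series $\rho(\xi)=\sum_{k\ge1}\rho_k\xi^k$, $U(\xi)=\sum_{k\ge1}U_k\xi^k$, $W(\xi)=\sum_{k\ge1}W_k\xi^k$ (so $W_k=kU_{k+1}$) with $\rho_k=0$ for $k<s$ and $\rho_s$ the prescribed positive number (the equations then force $U_1=((1-s)c_l-2)/s$ and determine all other coefficients recursively), extended to all $\xi>0$ as a solution of the local system, which is a regular ODE system along the solution because $c_l\xi+U(\xi)>0$ for $\xi>0$. Under the decay condition $U(\xi)/\xi\to0$, the relation $(U/\xi)'=W/\xi$ is equivalent to $U(\xi)=-\xi\int_\xi^\infty W(\eta)/\eta\,\mathrm{d}\eta$,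 so the profile solves the full self-similar equations. *)

theory Defs
  imports "HOL-Analysis.Analysis"
begin

text \<open>
  One-sided version of the library's \<open>has_fps_expansion\<close>: the expansion at 0 is only required
  on the part of a neighbourhood of 0 that lies in \<open>S\<close>.
  It is used with \<open>S = {0..}\<close> (functions on the closed half-line) and \<open>S = {0<..}\<close>
  (functions for which only small positive arguments matter).
\<close>

definition has_fps_expansion_within :: "(real \<Rightarrow> real) \<Rightarrow> real fps \<Rightarrow> real set \<Rightarrow> bool" where
  "has_fps_expansion_within f F S \<longleftrightarrow>
     fps_conv_radius F > 0 \<and> (\<forall>\<^sub>F x in nhds 0. x \<in> S \<longrightarrow> eval_fps F x = f x)"

definition analytic_at_0_within :: "(real \<Rightarrow> real) \<Rightarrow> real set \<Rightarrow> bool" where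
  "analytic_at_0_within f S \<longleftrightarrow> (\<exists>F. has_fps_expansion_within f F S)"

definition local_system ::
    "real \<Rightarrow> (real \<Rightarrow> real) \<Rightarrow> (real \<Rightarrow> real) \<Rightarrow> (real \<Rightarrow> real) \<Rightarrow> real \<Rightarrow> bool" where
  "local_system c\<^sub>l \<rho> U W \<xi> \<longleftrightarrow>
     \<rho> differentiable (at \<xi>) \<and> U differentiable (at \<xi>) \<and> W differentiable (at \<xi>) \<and>
     (2 - c\<^sub>l) * \<rho> \<xi> + c\<^sub>l * \<xi> * deriv \<rho> \<xi> + U \<xi> * deriv \<rho> \<xi> = 0 \<and>
     W \<xi> + c\<^sub>l * \<xi> * deriv W \<xi> + U \<xi> * deriv W \<xi> - deriv \<rho> \<xi> = 0 \<and>
     deriv (\<lambda>x. U x / x) \<xi> = W \<xi> / \<xi>"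

text \<open>
  The profile is a triple of functions on \<open>[0,\<infinity>)\<close>; values at negative arguments are irrelevant.
  The formulas for \<open>U\<^sub>1\<close>, for \<open>W\<^sub>k = k U\<^sub>k\<^sub>+\<^sub>1\<close> and for the remaining coefficients are forced
  by the local system, so they are not clauses of the definition. The same holds for the inequality
  \<open>c\<^sub>l \<xi> + U \<xi> > 0\<close> when \<open>c\<^sub>l > 2\<close> and \<open>\<rho>\<^sub>s > 0\<close>: it holds near 0, where
  \<open>c\<^sub>l + U\<^sub>1 = (c\<^sub>l - 2) / s\<close>; while it holds, \<open>\<rho>\<close> is positive and increasing; at a first zero
  of \<open>c\<^sub>l \<xi> + U \<xi>\<close> the first equation would give \<open>\<rho> \<xi> = 0\<close>.
\<close>

definition constructed_profile ::
    "nat \<Rightarrow> real \<Rightarrow> real \<Rightarrow> (real \<Rightarrow> real) \<Rightarrow> (real \<Rightarrow> real) \<Rightarrow> (real \<Rightarrow> real) \<Rightarrow> bool" where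
  "constructed_profile s c\<^sub>l \<rho>\<^sub>s \<rho> U W \<longleftrightarrow>
     (\<exists>R V \<Omega> :: real fps.
        has_fps_expansion_within \<rho> R {0..} \<and>
        has_fps_expansion_within U V {0..} \<and>
        has_fps_expansion_within W \<Omega> {0..} \<and>
        fps_nth R 0 = 0 \<and> fps_nth V 0 = 0 \<and> fps_nth \<Omega> 0 = 0 \<and>
        (\<forall>k<s. fps_nth R k = 0) \<and> fps_nth R s = \<rho>\<^sub>s) \<and>
     (\<forall>\<xi>>0. local_system c\<^sub>l \<rho> U W \<xi>)"

end

theory Submission
  imports Defs
begin

text \<open>
  The near-field part is immediate: a constructed profile comes with its power series at 0. The work
  is in the far field.

  Let \<open>x = \<xi>\<^bsup>-1/c\<^esup>\<close>. The decay condition says that \<open>b = - (U / \<xi>) / c\<close> tends to 0 as \<open>x \<rightarrow> 0\<close>.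
  Linearising the local system about \<open>b = W = \<rho> / \<xi> = 0\<close> suggests that \<open>b\<close> and \<open>W\<close>
  are of order \<open>x\<close> and that \<open>\<rho> / \<xi>\<close> is of order \<open>x\<^sup>2\<close>. Accordingly put \<open>k = c - 2\<close> and

    \<open>w = W / x\<close>,  \<open>a = b / x\<close>,  \<open>P = (k / c) (\<rho> / \<xi>) / x\<^sup>2\<close>,  \<open>G = 1 / (1 - b)\<close>.

  In these unknowns the local system becomes polynomial (\<open>far_field_system\<close>):

    \<open>P' = - k P a G\<close>,  \<open>w' = w a G - P G\<^sup>2\<close>,  \<open>G' = w G\<^sup>2\<close>,  \<open>(x a)' = w\<close>.

  The last relation makes \<open>a\<close> the average of \<open>w\<close> over \<open>[0, x]\<close>, so \<open>x = 0\<close> behaves like a regular point: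
  for any values of \<open>P\<close> and \<open>w\<close> at 0, and \<open>G = 1\<close> there, a convergent power series
  solution exists by the method of majorants (\<open>far_field_series_exists\<close>), and bounded solutions with the
  same limits agree near 0 (\<open>far_field_solution_unique\<close>).

  What remains is to show that the unknowns built from the profile do have limits at 0, although \<open>b \<rightarrow> 0\<close>
  is given without a rate. This is \<open>far_field_limits\<close>, where an energy estimate for \<open>P\<^sup>2 + w\<^sup>2\<close> is used
  twice, each time improving the decay of \<open>b\<close>. So the profile coincides with the series for small \<open>x\<close>, and
  \<open>W = x w\<close>, \<open>U / \<xi> = - c x a\<close> and \<open>\<rho> / \<xi> = (c / k) x\<^sup>2 P\<close> are analytic in \<open>x\<close>.
\<close>

unbundle no vec_syntax
unbundle fps_syntax

section \<open>Convergent power series solutions by majorants\<close>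

text \<open>
  The differential equation \<open>m' = K m\<^sup>3\<close> is separable, with solution
  \<open>m = A (1 - B x)\<^bsup>-1/2\<^esup>\<close>, where \<open>B = 2 K A\<^sup>2\<close>. As a power series it is a rescaled binomial
  series, whose coefficients are dominated by a geometric sequence.
\<close>

lemma cubic_majorant:
  fixes A K :: real
  assumes "A > 0" "K > 0"
  obtains m :: "real fps" where "m $ 0 = A" "fps_deriv m = fps_const K * (m * m * m)"
    "fps_conv_radius m > 0"
proof -
  define B where "B = 2 * K * A\<^sup>2"
  define b where "b = fps_binomial (- 1 / 2 :: real)"
  define s where "s = b oo (fps_const (- B) * fps_X)"
  define m where "m = fps_const A * s"
  have B: "B > 0" using assms by (simp add: B_def)
  have m_nth: "m $ n = A * B ^ n * (pochhammer (1 / 2) n / fact n)" for n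
  proof -
    have "((-1) ^ n * (-1) ^ n :: real) = 1" by (simp flip: power_mult_distrib)
    moreover have "m $ n = ((-1) ^ n * (-1) ^ n) * (A * B ^ n * (pochhammer (1 / 2) n / fact n))"
      by (simp only: m_def s_def b_def fps_mult_left_const_nth fps_nth_compose_linear
            fps_binomial_nth gbinomial_pochhammer power_minus[of B]) simp
    ultimately show ?thesis by simp
  qed
  have "m $ 0 = A" by (simp add: m_nth)
  moreover have "fps_deriv m = fps_const K * (m * m * m)"
  proof -
    have "b * b = inverse (1 + fps_X)"
      unfolding b_def by (simp flip: fps_binomial_add_mult fps_binomial_minus_one)
    then have "fps_deriv b = fps_const (- 1 / 2) * (b * b * b)"
      unfolding b_def fps_binomial_deriv by (simp add: fps_divide_unit b_def mult_ac)
    then have "fps_deriv s = fps_const (- 1 / 2) * (s * s * s) * fps_const (- B)"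
      unfolding s_def by (simp add: fps_compose_deriv fps_compose_mult_distrib)
    then have "fps_deriv m = fps_const (A * (- 1 / 2) * (- B)) * (s * s * s)"
      unfolding m_def by (simp flip: fps_const_mult add: mult_ac)
    also have "A * (- 1 / 2) * (- B) = K * A * A * A"
      by (simp add: B_def power2_eq_square)
    finally show ?thesis
      unfolding m_def by (simp only: fps_const_mult[symmetric] mult_ac)
  qed
  moreover have "fps_conv_radius m > 0"
  proof -
    \<comment> \<open>Any point inside the disc of radius \<open>1 / B\<close> would do; \<open>1 / (2 B)\<close> gives the ratio \<open>1 / 2\<close>.\<close>
    have "norm (m $ n * (1 / (2 * B)) ^ n) \<le> A * (1 / 2) ^ n" for n
    proof -
      have p: "pochhammer (1 / 2 :: real) n \<le> fact n"
        unfolding pochhammer_fact pochhammer_prod by (intro prod_mono) auto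
      have "0 \<le> pochhammer (1 / 2 :: real) n" by (intro pochhammer_nonneg) auto
      then show ?thesis using p assms B
        by (simp add: m_nth power_divide power_mult_distrib abs_mult divide_simps)
    qed
    moreover have "summable (\<lambda>n. A * (1 / 2 :: real) ^ n)"
      by (rule summable_mult, rule summable_geometric) simp
    ultimately have "summable (\<lambda>n. m $ n * (1 / (2 * B)) ^ n)"
      by (rule summable_comparison_test'[where N = 0, rotated])
    from conv_radius_geI[OF this] have "ereal (norm (1 / (2 * B))) \<le> fps_conv_radius m"
      by (simp only: fps_conv_radius_def)
    moreover have "0 < ereal (norm (1 / (2 * B)))" using B by simp
    ultimately show ?thesis by (rule less_le_trans[rotated])
  qed
  ultimately show ?thesis using that by blast
qed

lemma fps_mult_nth_majorant:
  fixes f g p q :: "real fps"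
  assumes "\<And>j. j \<le> n \<Longrightarrow> \<bar>f $ j\<bar> \<le> p $ j" "\<And>j. j \<le> n \<Longrightarrow> \<bar>g $ j\<bar> \<le> q $ j"
  shows "\<bar>(f * g) $ n\<bar> \<le> (p * q) $ n"
proof -
  have "\<bar>(f * g) $ n\<bar> \<le> (\<Sum>i=0..n. \<bar>f $ i * g $ (n - i)\<bar>)"
    unfolding fps_mult_nth by (rule sum_abs)
  also have "\<dots> \<le> (\<Sum>i=0..n. p $ i * q $ (n - i))"
    unfolding abs_mult
    by (intro sum_mono mult_mono assms order_trans[OF abs_ge_zero assms(1)]) auto
  finally show ?thesis by (simp add: fps_mult_nth)
qed

lemma fps_mult_nth_cong:
  assumes "\<And>j. j \<le> n \<Longrightarrow> f $ j = f' $ j" "\<And>j. j \<le> n \<Longrightarrow> g $ j = g' $ j"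
  shows "(f * g) $ n = (f' * g') $ n"
  unfolding fps_mult_nth by (intro sum.cong) (auto simp: assms)

lemma fps_conv_radius_mono:
  fixes f m :: "real fps"
  assumes "\<And>n. \<bar>f $ n\<bar> \<le> m $ n"
  shows "fps_conv_radius m \<le> fps_conv_radius f"
  unfolding fps_conv_radius_def
proof (rule conv_radius_geI_ex')
  fix r :: real assume r: "0 < r" "ereal r < conv_radius (fps_nth m)"
  have "summable (\<lambda>n. m $ n * r ^ n)"
    using r by (intro summable_in_conv_radius) auto
  then show "summable (\<lambda>n. f $ n * of_real r ^ n)"
    by (rule summable_comparison_test')
       (use assms r in \<open>auto simp: abs_mult intro!: mult_right_mono\<close>)
qed

text \<open>
  Call an operator on families of power series causal if the coefficients of its value up to
  order \<open>n\<close> depend only on the coefficients of its argument up to order \<open>n\<close>. Each Picard step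
  \<open>X \<mapsto> c + \<integral> \<Phi> X\<close> then fixes one more coefficient for good, so the diagonal of the iterates
  solves the initial value problem.
\<close>

lemma causal_fps_ode_exists:
  fixes \<Phi> :: "('i \<Rightarrow> 'a :: field_char_0 fps) \<Rightarrow> 'i \<Rightarrow> 'a fps" and c :: "'i \<Rightarrow> 'a"
  assumes causal: "\<And>X Y n i. (\<And>j k. k \<le> n \<Longrightarrow> X j $ k = Y j $ k) \<Longrightarrow> \<Phi> X i $ n = \<Phi> Y i $ n"
  obtains X where "\<And>i. X i $ 0 = c i" "\<And>i. fps_deriv (X i) = \<Phi> X i"
proof -
  define Z where "Z = rec_nat (\<lambda>i. fps_const (c i)) (\<lambda>_ X i. fps_integral (\<Phi> X i) (c i))"
  have Z0: "Z 0 = (\<lambda>i. fps_const (c i))" and ZS: "Z (Suc k) = (\<lambda>i. fps_integral (\<Phi> (Z k) i) (c i))" for k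
    by (simp_all add: Z_def)
  have Z_0: "Z k i $ 0 = c i" for k i by (cases k) (simp_all add: Z0 ZS)
  have stable: "n \<le> k \<Longrightarrow> n \<le> l \<Longrightarrow> Z k i $ n = Z l i $ n" for n k l i
  proof (induction n arbitrary: k l i rule: less_induct)
    case (less n)
    show ?case
    proof (cases n)
      case 0
      then show ?thesis by (simp add: Z_0)
    next
      case (Suc n')
      with less.prems obtain k' l' where kl: "k = Suc k'" "l = Suc l'" "n' \<le> k'" "n' \<le> l'"
        by (metis Suc_le_D Suc_le_mono)
      have "\<Phi> (Z k') i $ n' = \<Phi> (Z l') i $ n'"
        by (intro causal less.IH) (use kl Suc in auto)
      then show ?thesis by (simp add: kl Suc ZS)
    qed
  qed
  define X where "X = (\<lambda>i. Abs_fps (\<lambda>n. Z n i $ n))"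
  have "X i $ 0 = c i" for i by (simp add: X_def Z_0)
  moreover have "fps_deriv (X i) = \<Phi> X i" for i
  proof (rule fps_ext)
    fix n
    have "\<Phi> (Z n) i $ n = \<Phi> X i $ n"
      by (intro causal) (auto simp: X_def intro: stable)
    then show "fps_deriv (X i) $ n = \<Phi> X i $ n"
      by (simp add: X_def ZS field_simps del: of_nat_Suc)
  qed
  ultimately show ?thesis using that by blast
qed

text \<open>
  The series of \<open>x \<mapsto> (1 / x) \<integral>\<^sub>0\<^sup>x f\<close>, the mean value of \<open>f\<close> over \<open>[0, x]\<close>. The nonlocal
  relation \<open>(x a)' = w\<close> of the far-field system says that \<open>a\<close> is the average of \<open>w\<close>. Averaging
  does not increase coefficients, so it costs nothing in a majorant argument.
\<close>

definition fps_average :: "real fps \<Rightarrow> real fps" where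
  "fps_average f = Abs_fps (\<lambda>n. f $ n / real (Suc n))"

lemma fps_average_nth_bound: "\<bar>fps_average f $ n\<bar> \<le> \<bar>f $ n\<bar>"
  by (simp add: fps_average_def divide_le_eq mult_le_cancel_left1 del: of_nat_Suc) 

lemma fps_deriv_X_mult_average: "fps_deriv (fps_X * fps_average f) = f"
proof (rule fps_ext)
  show "fps_deriv (fps_X * fps_average f) $ n = f $ n" for n
    by (simp only: fps_deriv_nth fps_average_def) (simp del: of_nat_Suc)
qed

text \<open>
  The right-hand sides of the far-field system are cubic, with coefficients of total size at most
  \<open>k + 2\<close>. Hence, by induction on the order, the coefficients of the formal solution are dominated by
  those of the solution of \<open>m' = (k + 2) m\<^sup>3\<close> whose value at 0 exceeds all the initial values.
\<close>

lemma far_field_series_exists: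
  fixes k P\<^sub>0 w\<^sub>0 :: real
  assumes k: "k \<ge> 0"
  obtains P w a G :: "real fps" where
    "P $ 0 = P\<^sub>0" "w $ 0 = w\<^sub>0" "G $ 0 = 1"
    "fps_deriv P = fps_const (- k) * (P * a * G)"
    "fps_deriv w = w * a * G - P * G * G"
    "fps_deriv G = w * G * G"
    "fps_deriv (fps_X * a) = w"
    "fps_conv_radius P > 0" "fps_conv_radius w > 0" "fps_conv_radius a > 0" "fps_conv_radius G > 0"
proof -
  define \<Phi> :: "(nat \<Rightarrow> real fps) \<Rightarrow> nat \<Rightarrow> real fps" where
    "\<Phi> = (\<lambda>F i. if i = 0 then fps_const (- k) * (F 0 * fps_average (F 1) * F 2)
        else if i = 1 then F 1 * fps_average (F 1) * F 2 - F 0 * F 2 * F 2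
        else F 1 * F 2 * F 2)"
  define ini where "ini = (\<lambda>i::nat. if i = 0 then P\<^sub>0 else if i = 1 then w\<^sub>0 else 1)"
  have "\<Phi> X i $ n = \<Phi> Y i $ n" if "\<And>j k. k \<le> n \<Longrightarrow> X j $ k = Y j $ k" for X Y n i
  proof -
    have "(X j1 * X j2 * X j3) $ n = (Y j1 * Y j2 * Y j3) $ n"
         "(X j1 * fps_average (X j2) * X j3) $ n = (Y j1 * fps_average (Y j2) * Y j3) $ n"
      for j1 j2 j3
      by (intro fps_mult_nth_cong that; simp add: fps_average_def that)+
    then show ?thesis by (simp add: \<Phi>_def)
  qed
  then obtain F where F0: "\<And>i. F i $ 0 = ini i" and F: "\<And>i. fps_deriv (F i) = \<Phi> F i"
    by (rule causal_fps_ode_exists[of \<Phi> ini]) blast+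
  obtain m :: "real fps" where m0: "m $ 0 = 1 + \<bar>P\<^sub>0\<bar> + \<bar>w\<^sub>0\<bar>"
    and m': "fps_deriv m = fps_const (k + 2) * (m * m * m)" and mr: "fps_conv_radius m > 0"
    using cubic_majorant[of "1 + \<bar>P\<^sub>0\<bar> + \<bar>w\<^sub>0\<bar>" "k + 2"] k
    by (metis abs_ge_zero add_nonneg_nonneg add_nonneg_pos add_pos_nonneg zero_less_numeral zero_less_one)
  have bound: "\<bar>F i $ n\<bar> \<le> m $ n" for i n
  proof (induction n arbitrary: i rule: less_induct)
    case (less n)
    show ?case
    proof (cases n)
      case 0
      then show ?thesis by (simp add: F0 ini_def m0)
    next
      case (Suc n')
      have avg: "\<bar>fps_average (F i) $ j\<bar> \<le> m $ j" if "j \<le> n'" for i j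
        using fps_average_nth_bound[of "F i" j] less.IH[of j i] that Suc by linarith
      have p1: "\<bar>(F i * F j * F l) $ n'\<bar> \<le> (m * m * m) $ n'" for i j l
        by (intro fps_mult_nth_majorant less.IH) (use Suc in auto)
      have p2: "\<bar>(F i * fps_average (F j) * F l) $ n'\<bar> \<le> (m * m * m) $ n'" for i j l
        by (intro fps_mult_nth_majorant less.IH avg) (use Suc in auto)
      let ?m = "(m * m * m) $ n'"
      have "\<bar>\<Phi> F i $ n'\<bar> \<le> (k + 2) * ?m"
      proof -
        have m_pos: "0 \<le> ?m" using p1[of 0 0 0] by linarith
        then have km: "0 \<le> k * ?m" using k by simp
        have "k * \<bar>(F 0 * fps_average (F 1) * F 2) $ n'\<bar> \<le> k * ?m"
          by (intro mult_left_mono p2 k)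
        then show ?thesis
          using p2[of 1 1 2] p1[of 0 2 2] p1[of 1 2 2] m_pos km k
          by (auto simp: \<Phi>_def abs_mult ring_distribs; linarith)
      qed
      moreover have "real n * F i $ n = \<Phi> F i $ n'"
        using F[of i] Suc by (metis fps_deriv_nth Suc_eq_plus1 of_nat_Suc)
      moreover have "real n * m $ n = (k + 2) * ?m"
        using arg_cong[OF m', of "\<lambda>f. f $ n'"] Suc by simp
      ultimately have "real n * \<bar>F i $ n\<bar> \<le> real n * m $ n"
        by (metis abs_mult abs_of_nat)
      then show ?thesis using Suc by (simp del: of_nat_Suc)
    qed
  qed
  have "\<bar>fps_average (F 1) $ n\<bar> \<le> m $ n" for n
    using fps_average_nth_bound[of "F 1" n] bound[of 1 n] by linarith
  with mr have "fps_conv_radius (fps_average (F 1)) > 0"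
    by (meson fps_conv_radius_mono less_le_trans)
  moreover have "fps_conv_radius (F i) > 0" for i
    using mr bound by (meson fps_conv_radius_mono less_le_trans)
  ultimately show ?thesis
    using F[of 0] F[of 1] F[of 2] F0[of 0] F0[of 1] F0[of 2]
    by (intro that[of "F 0" "F 1" "F 2" "fps_average (F 1)"] fps_deriv_X_mult_average)
       (simp_all add: \<Phi>_def ini_def)
qed

section \<open>Estimates from derivatives on an interval with left end point 0\<close>

text \<open>
  The functions below live on an interval \<open>(0, d)\<close>, and all that is known at its left end point is
  a limit. So monotonicity and mean value estimates are needed with this limit in place of a
  value.
\<close>

lemma nonneg_if_deriv_nonneg_from_0:
  fixes f f' :: "real \<Rightarrow> real"
  assumes f': "\<And>x. 0 < x \<Longrightarrow> x < d \<Longrightarrow> (f has_real_derivative f' x) (at x)"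
    and nonneg: "\<And>x. 0 < x \<Longrightarrow> x < d \<Longrightarrow> f' x \<ge> 0"
    and lim: "(f \<longlongrightarrow> 0) (at_right 0)" and x: "0 < x" "x < d"
  shows "f x \<ge> 0"
proof (rule tendsto_upperbound[OF lim])
  have "eventually (\<lambda>y. y \<in> {0<..<x}) (at_right 0)"
    using x by (intro eventually_at_right_real)
  then show "\<forall>\<^sub>F y in at_right 0. f y \<le> f x"
  proof eventually_elim
    case (elim y)
    show ?case
    proof (rule DERIV_nonneg_imp_nondecreasing[of y x f])
      fix z assume "y \<le> z" "z \<le> x"
      then have "0 < z" "z < d" using elim x by auto
      then show "\<exists>D. (f has_real_derivative D) (at z) \<and> D \<ge> 0"
        using f' nonneg by blast
    qed (use elim in auto)
  qed
qed simp

lemma abs_le_if_abs_deriv_le_from_0: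
  fixes f f' h h' :: "real \<Rightarrow> real"
  assumes f': "\<And>x. 0 < x \<Longrightarrow> x < d \<Longrightarrow> (f has_real_derivative f' x) (at x)"
    and h': "\<And>x. 0 < x \<Longrightarrow> x < d \<Longrightarrow> (h has_real_derivative h' x) (at x)"
    and le: "\<And>x. 0 < x \<Longrightarrow> x < d \<Longrightarrow> \<bar>f' x\<bar> \<le> h' x"
    and lim: "(f \<longlongrightarrow> 0) (at_right 0)" "(h \<longlongrightarrow> 0) (at_right 0)" and x: "0 < x" "x < d"
  shows "\<bar>f x\<bar> \<le> h x"
proof -
  have "h x - f x \<ge> 0"
  proof (rule nonneg_if_deriv_nonneg_from_0[where f = "\<lambda>x. h x - f x", OF _ _ _ x])
    show "((\<lambda>x. h x - f x) has_real_derivative h' z - f' z) (at z)" if "0 < z" "z < d" for z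
      using that by (intro DERIV_diff h' f')
    show "h' z - f' z \<ge> 0" if "0 < z" "z < d" for z
      using le[OF that] by linarith
    show "((\<lambda>x. h x - f x) \<longlongrightarrow> 0) (at_right 0)"
      using tendsto_diff[OF lim(2,1)] by simp
  qed
  moreover have "h x + f x \<ge> 0"
  proof (rule nonneg_if_deriv_nonneg_from_0[where f = "\<lambda>x. h x + f x", OF _ _ _ x])
    show "((\<lambda>x. h x + f x) has_real_derivative h' z + f' z) (at z)" if "0 < z" "z < d" for z
      using that by (intro DERIV_add h' f')
    show "h' z + f' z \<ge> 0" if "0 < z" "z < d" for z
      using le[OF that] by linarith
    show "((\<lambda>x. h x + f x) \<longlongrightarrow> 0) (at_right 0)"
      using tendsto_add[OF lim(2,1)] by simp
  qed
  ultimately show ?thesis by linarith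
qed

lemma abs_le_mult_if_abs_deriv_le_from_0:
  fixes f f' :: "real \<Rightarrow> real"
  assumes "\<And>x. 0 < x \<Longrightarrow> x < d \<Longrightarrow> (f has_real_derivative f' x) (at x)"
    and "\<And>x. 0 < x \<Longrightarrow> x < d \<Longrightarrow> \<bar>f' x\<bar> \<le> C"
    and "(f \<longlongrightarrow> 0) (at_right 0)" and "0 < x" "x < d"
  shows "\<bar>f x\<bar> \<le> C * x"
proof (rule abs_le_if_abs_deriv_le_from_0[where f = f and f' = f' and h = "\<lambda>x. C * x" and h' = "\<lambda>_. C"])
  show "((\<lambda>x. C * x) \<longlongrightarrow> 0) (at_right 0)"
    by (rule tendsto_mult_right_zero) simp
qed (use assms in \<open>auto intro!: derivative_eq_intros\<close>)

text \<open>
  A bounded derivative makes the function Lipschitz, hence uniformly continuous, and so it extends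
  to the closure of its domain.
\<close>

lemma tendsto_at_right_0_if_deriv_bounded:
  fixes f f' :: "real \<Rightarrow> real"
  assumes d: "d > 0"
    and f': "\<And>x. 0 < x \<Longrightarrow> x < d \<Longrightarrow> (f has_real_derivative f' x) (at x)"
    and le: "\<And>x. 0 < x \<Longrightarrow> x < d \<Longrightarrow> \<bar>f' x\<bar> \<le> C"
  obtains l where "(f \<longlongrightarrow> l) (at_right 0)"
proof -
  have "C \<ge> 0" using le[of "d / 2"] d by simp
  moreover have "norm (f x - f y) \<le> C * norm (x - y)" if "x \<in> {0<..<d}" "y \<in> {0<..<d}" for x y
  proof (rule field_differentiable_bound[of "{0<..<d}" f f'])
    show "(f has_real_derivative f' z) (at z within {0<..<d})" if "z \<in> {0<..<d}" for z
      using f'[of z] that by (simp add: has_field_derivative_at_within)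
    show "norm (f' z) \<le> C" if "z \<in> {0<..<d}" for z
      using that le by simp
  qed (use that in simp_all)
  ultimately have "C-lipschitz_on {0<..<d} f"
    by (intro lipschitz_onI) (simp_all add: dist_norm)
  then have uc: "uniformly_continuous_on {0<..<d} f"
    by (rule lipschitz_on_uniformly_continuous)
  have "0 \<in> closure {0<..<d}" using d by simp
  from uniformly_continuous_on_extension_at_closure[OF uc this]
  obtain l where "(f \<longlongrightarrow> l) (at 0 within {0<..<d})" by blast
  also have "at 0 within {0<..<d} = at_right 0"
    using d by (intro at_within_nhd[of 0 "{..<d}"]) auto
  finally show ?thesis using that by blast
qed

lemma abs_mult3_diff_le:
  fixes a b c a' b' c' :: real
  assumes "\<bar>a\<bar> \<le> M" "\<bar>b\<bar> \<le> M" "\<bar>c\<bar> \<le> M" "\<bar>a'\<bar> \<le> M" "\<bar>b'\<bar> \<le> M" "\<bar>c'\<bar> \<le> M"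
    and "\<bar>a - a'\<bar> \<le> B" "\<bar>b - b'\<bar> \<le> B" "\<bar>c - c'\<bar> \<le> B"
  shows "\<bar>a * b * c - a' * b' * c'\<bar> \<le> 3 * M\<^sup>2 * B"
proof -
  have "M \<ge> 0" "B \<ge> 0" using assms(1,7) by linarith+
  have "a * b * c - a' * b' * c' = (a - a') * b * c + a' * (b - b') * c + a' * b' * (c - c')"
    by (simp add: algebra_simps)
  moreover have "\<bar>(a - a') * b * c\<bar> \<le> B * M * M" "\<bar>a' * (b - b') * c\<bar> \<le> M * B * M"
    "\<bar>a' * b' * (c - c')\<bar> \<le> M * M * B"
    unfolding abs_mult
    by (intro mult_mono mult_nonneg_nonneg abs_ge_zero assms \<open>M \<ge> 0\<close> \<open>B \<ge> 0\<close>)+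
  moreover have "B * M * M + M * B * M + M * M * B = 3 * M\<^sup>2 * B"
    by (simp add: power2_eq_square)
  ultimately show ?thesis by linarith
qed

section \<open>Uniqueness for the far-field system\<close>

text \<open>
  The system that the profile satisfies in the far field, in the variable \<open>x = \<xi>\<^bsup>-1/c\<^esup>\<close>.
  With \<open>k = c - 2\<close> it is obeyed by \<open>w = W / x\<close>, \<open>a = - (U / \<xi>) / (c x)\<close>, \<open>G = 1 / (1 - x a)\<close>
  and \<open>P = (k / c) (\<rho> / \<xi>) / x\<^sup>2\<close>. These powers of \<open>x\<close> are the decay rates of the linearisation
  at infinity; dividing by them removes the singularity at \<open>x = 0\<close>, up to
  the relation \<open>(x a)' = w\<close>. Keeping the reciprocal \<open>G\<close> as an unknown makes the system polynomial.
\<close>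

definition far_field_solution ::
    "real \<Rightarrow> real \<Rightarrow> (real \<Rightarrow> real) \<Rightarrow> (real \<Rightarrow> real) \<Rightarrow> (real \<Rightarrow> real) \<Rightarrow> (real \<Rightarrow> real) \<Rightarrow> bool" where
  "far_field_solution k d P w a G \<longleftrightarrow> (\<forall>x. 0 < x \<longrightarrow> x < d \<longrightarrow>
     (P has_real_derivative - k * (P x * a x * G x)) (at x) \<and>
     (w has_real_derivative w x * a x * G x - P x * G x * G x) (at x) \<and>
     (G has_real_derivative w x * G x * G x) (at x) \<and>
     ((\<lambda>x. x * a x) has_real_derivative w x) (at x))"

text \<open>
  The relation \<open>(x a)' = w\<close> is singular at 0, so a pointwise Gronwall estimate for
  the sum of squares of the differences does not close up. Suprema work instead: if all differences are bounded by
  \<open>B\<close> on \<open>(0, e)\<close>, then those of \<open>P\<close>, \<open>w\<close>, \<open>G\<close> are at most \<open>L B x\<close>, and averaging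
  passes the bound for \<open>w\<close> on to \<open>a\<close>. For small \<open>e\<close> this improves \<open>B\<close> to \<open>B / 2\<close>.
\<close>

lemma far_field_solution_unique:
  fixes P w a G P' w' a' G' :: "real \<Rightarrow> real"
  assumes "k \<ge> 0" and d: "d > 0"
    and sol: "far_field_solution k d P w a G" "far_field_solution k d P' w' a' G'"
    and bd: "\<And>x f. 0 < x \<Longrightarrow> x < d \<Longrightarrow> f \<in> {P, w, a, G, P', w', a', G'} \<Longrightarrow> \<bar>f x\<bar> \<le> M"
    and lim: "((\<lambda>x. P x - P' x) \<longlongrightarrow> 0) (at_right 0)" "((\<lambda>x. w x - w' x) \<longlongrightarrow> 0) (at_right 0)"
      "((\<lambda>x. G x - G' x) \<longlongrightarrow> 0) (at_right 0)" "((\<lambda>x. x * a x - x * a' x) \<longlongrightarrow> 0) (at_right 0)"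
  obtains e where "e > 0"
    "\<And>x. 0 < x \<Longrightarrow> x < e \<Longrightarrow> P x = P' x \<and> w x = w' x \<and> a x = a' x \<and> G x = G' x"
proof -
  define L where "L = (3 * k + 6) * M\<^sup>2"
  \<comment> \<open>Any \<open>e \<le> d\<close> with \<open>L e \<le> 1 / 2\<close>; the summand 1 covers \<open>L = 0\<close>.\<close>
  define e where "e = min d (1 / (2 * (L + 1)))"
  have L: "L \<ge> 0" using assms(1) by (simp add: L_def)
  have e: "e > 0" "e \<le> d" "L * e \<le> 1 / 2"
  proof -
    show "e > 0" "e \<le> d" using d L by (auto simp: e_def)
    have "L * e \<le> L * (1 / (2 * (L + 1)))" using L by (intro mult_left_mono) (auto simp: e_def)
    also have "\<dots> \<le> 1 / 2" using L by (simp add: field_simps)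
    finally show "L * e \<le> 1 / 2" .
  qed
  define S where "S = {(P, P'), (w, w'), (a, a'), (G, G')}"
  have S: "(P, P') \<in> S" "(w, w') \<in> S" "(a, a') \<in> S" "(G, G') \<in> S"
    by (simp_all add: S_def)
  have bdS: "\<bar>f x\<bar> \<le> M" "\<bar>g x\<bar> \<le> M" if "(f, g) \<in> S" "0 < x" "x < e" for f g x
    by (rule bd; use that e in \<open>auto simp: S_def\<close>)+
  define close where "close = (\<lambda>B. \<forall>x. 0 < x \<longrightarrow> x < e \<longrightarrow> (\<forall>(f, g)\<in>S. \<bar>f x - g x\<bar> \<le> B))"
  have closeD: "\<bar>f x - g x\<bar> \<le> B" if "close B" "(f, g) \<in> S" "0 < x" "x < e" for f g x B
    using that unfolding close_def by blast
  have improve: "close (B / 2)" if "close B" for B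
  proof -
    have "\<bar>P (e / 2) - P' (e / 2)\<bar> \<le> B" using e(1) by (intro closeD[OF that] S) auto
    then have B: "B \<ge> 0" by linarith
    have cube: "\<bar>f1 x * f2 x * f3 x - g1 x * g2 x * g3 x\<bar> \<le> 3 * M\<^sup>2 * B"
      if x: "0 < x" "x < e" and "(f1, g1) \<in> S" "(f2, g2) \<in> S" "(f3, g3) \<in> S"
      for x f1 f2 f3 g1 g2 g3
      by (intro abs_mult3_diff_le bdS[OF that(3) x] bdS[OF that(4) x] bdS[OF that(5) x]
            closeD[OF \<open>close B\<close> _ x] that)
    have M: "M\<^sup>2 * B \<ge> 0" "k * (M\<^sup>2 * B) \<ge> 0" using B assms(1) by auto
    have P: "\<bar>P x - P' x\<bar> \<le> L * B * x" if "0 < x" "x < e" for x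
    proof (rule abs_le_mult_if_abs_deriv_le_from_0[where f = "\<lambda>x. P x - P' x", OF _ _ lim(1) that])
      fix x assume x: "0 < x" "x < e"
      show "((\<lambda>x. P x - P' x) has_real_derivative - k * (P x * a x * G x - P' x * a' x * G' x)) (at x)"
        using sol x e by (auto simp: far_field_solution_def right_diff_distrib
            intro!: derivative_eq_intros)
      have "k * \<bar>P x * a x * G x - P' x * a' x * G' x\<bar> \<le> k * (3 * M\<^sup>2 * B)"
        using x S assms(1) by (intro mult_left_mono cube)
      moreover have "L * B = k * (3 * M\<^sup>2 * B) + 6 * (M\<^sup>2 * B)"
        by (simp add: L_def algebra_simps)
      moreover have "\<bar>- k * (P x * a x * G x - P' x * a' x * G' x)\<bar>
          = k * \<bar>P x * a x * G x - P' x * a' x * G' x\<bar>"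
        using assms(1) by (simp add: abs_mult)
      ultimately show "\<bar>- k * (P x * a x * G x - P' x * a' x * G' x)\<bar> \<le> L * B"
        using M by linarith
    qed
    have w: "\<bar>w x - w' x\<bar> \<le> L * B * x" if "0 < x" "x < e" for x
    proof (rule abs_le_mult_if_abs_deriv_le_from_0[where f = "\<lambda>x. w x - w' x", OF _ _ lim(2) that])
      fix x assume x: "0 < x" "x < e"
      show "((\<lambda>x. w x - w' x) has_real_derivative
          (w x * a x * G x - w' x * a' x * G' x) - (P x * G x * G x - P' x * G' x * G' x)) (at x)"
        using sol x e by (auto simp: far_field_solution_def intro!: derivative_eq_intros)
      show "\<bar>(w x * a x * G x - w' x * a' x * G' x) - (P x * G x * G x - P' x * G' x * G' x)\<bar> \<le> L * B"
        using cube[OF x S(2,3,4)] cube[OF x S(1,4,4)] M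
        by (simp add: L_def algebra_simps)
    qed
    have G: "\<bar>G x - G' x\<bar> \<le> L * B * x" if "0 < x" "x < e" for x
    proof (rule abs_le_mult_if_abs_deriv_le_from_0[where f = "\<lambda>x. G x - G' x", OF _ _ lim(3) that])
      fix x assume x: "0 < x" "x < e"
      show "((\<lambda>x. G x - G' x) has_real_derivative
          (w x * G x * G x - w' x * G' x * G' x)) (at x)"
        using sol x e by (auto simp: far_field_solution_def intro!: derivative_eq_intros)
      show "\<bar>w x * G x * G x - w' x * G' x * G' x\<bar> \<le> L * B"
        using cube[OF x S(2,4,4)] M by (simp add: L_def algebra_simps)
    qed
    have half: "L * B * x \<le> B / 2" if "0 < x" "x < e" for x
    proof -
      have "L * x \<le> 1 / 2" using e(3) that L by (meson less_imp_le mult_left_mono order_trans)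
      then have "(L * x) * B \<le> (1 / 2) * B" using B by (intro mult_right_mono)
      then show ?thesis by (simp add: algebra_simps)
    qed
    \<comment> \<open>The improved bound for \<open>w\<close> is what makes the difference of \<open>a\<close> shrink.\<close>
    have a: "\<bar>a x - a' x\<bar> \<le> B / 2" if "0 < x" "x < e" for x
    proof -
      have "\<bar>x * a x - x * a' x\<bar> \<le> B / 2 * x"
      proof (rule abs_le_mult_if_abs_deriv_le_from_0[where f = "\<lambda>x. x * a x - x * a' x", OF _ _ lim(4) that])
        fix x assume x: "0 < x" "x < e"
        show "((\<lambda>x. x * a x - x * a' x) has_real_derivative (w x - w' x)) (at x)"
          using sol x e by (auto simp: far_field_solution_def intro!: DERIV_diff)
        show "\<bar>w x - w' x\<bar> \<le> B / 2" using w[OF x] half[OF x] by linarith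
      qed
      then have "x * \<bar>a x - a' x\<bar> \<le> x * (B / 2)"
        using that by (simp add: abs_mult flip: right_diff_distrib)
      then show ?thesis using that by simp
    qed
    have "\<bar>P x - P' x\<bar> \<le> B / 2" "\<bar>w x - w' x\<bar> \<le> B / 2" "\<bar>G x - G' x\<bar> \<le> B / 2"
      if "0 < x" "x < e" for x
      using P[OF that] w[OF that] G[OF that] half[OF that] by linarith+
    with a show ?thesis unfolding close_def S_def by auto
  qed
  have "close (2 * M / 2 ^ n)" for n
  proof (induction n)
    case 0
    have "\<bar>f x - g x\<bar> \<le> 2 * M" if "(f, g) \<in> S" "0 < x" "x < e" for f g x
      using bdS[OF that] by linarith
    then show ?case by (auto simp: close_def)
  next
    case (Suc n)
    from improve[OF this] show ?case by (simp add: mult.commute)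
  qed
  then have close: "\<bar>f x - g x\<bar> \<le> 2 * M / 2 ^ n" if "(f, g) \<in> S" "0 < x" "x < e" for f g x n
    using closeD that by blast
  have "(\<lambda>n. 2 * M * (1 / 2) ^ n) \<longlonglongrightarrow> 2 * M * 0"
    by (intro tendsto_mult tendsto_const LIMSEQ_power_zero) simp
  then have "(\<lambda>n. 2 * M / 2 ^ n) \<longlonglongrightarrow> 0" by (simp add: power_divide)
  then have "\<bar>f x - g x\<bar> \<le> 0" if "(f, g) \<in> S" "0 < x" "x < e" for f g x
    by (rule LIMSEQ_le_const) (use close[OF that] in auto)
  then have "f x = g x" if "(f, g) \<in> S" "0 < x" "x < e" for f g x
    using that by force
  with S show ?thesis by (intro that[OF e(1)]) auto
qed

section \<open>Existence of limits in the far field\<close>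

text \<open>
  Along a solution, with \<open>b = x a\<close>, the left-hand side is \<open>\<bar>x N'\<bar>\<close> for the energy \<open>N = P\<^sup>2 + w\<^sup>2\<close>. The
  point is that the factor in front of \<open>N\<close> tends to 0 with \<open>b\<close> and \<open>x\<close>.
\<close>

lemma far_field_energy_deriv:
  fixes k x P w b G :: real
  assumes "k \<ge> 0" "x \<ge> 0" "\<bar>G\<bar> \<le> 2"
  shows "\<bar>2 * P * (- k * P * b * G) + 2 * w * (w * b * G - x * P * G\<^sup>2)\<bar>
    \<le> (4 * (k + 1) * \<bar>b\<bar> + 4 * x) * (P\<^sup>2 + w\<^sup>2)"
proof -
  have bG: "\<bar>b * G\<bar> \<le> \<bar>b\<bar> * 2"
    unfolding abs_mult using assms by (intro mult_left_mono) auto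
  have "\<bar>2 * (w\<^sup>2 - k * P\<^sup>2)\<bar> \<le> 2 * (k + 1) * (P\<^sup>2 + w\<^sup>2)"
  proof -
    have "0 \<le> k * w\<^sup>2" "0 \<le> k * P\<^sup>2" using assms by auto
    then show ?thesis by (simp add: abs_le_iff algebra_simps)
  qed
  then have "\<bar>2 * (w\<^sup>2 - k * P\<^sup>2) * (b * G)\<bar> \<le> (2 * (k + 1) * (P\<^sup>2 + w\<^sup>2)) * (\<bar>b\<bar> * 2)"
    unfolding abs_mult[of "2 * (w\<^sup>2 - k * P\<^sup>2)"] using bG assms by (intro mult_mono) auto
  moreover have "\<bar>x * G\<^sup>2 * (2 * P * w)\<bar> \<le> (x * 4) * (P\<^sup>2 + w\<^sup>2)"
    unfolding abs_mult[of "x * G\<^sup>2"]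
  proof (rule mult_mono)
    have "G\<^sup>2 \<le> 2\<^sup>2" using assms by (intro power2_le_iff_abs_le[THEN iffD2]) auto
    then show "\<bar>x * G\<^sup>2\<bar> \<le> x * 4" using assms by (simp add: abs_mult mult_left_mono)
    show "\<bar>2 * P * w\<bar> \<le> P\<^sup>2 + w\<^sup>2"
      using sum_squares_bound[of P w] sum_squares_bound[of P "- w"] by (simp add: abs_le_iff)
  qed (use assms in auto)
  moreover have "2 * P * (- k * P * b * G) + 2 * w * (w * b * G - x * P * G\<^sup>2)
      = 2 * (w\<^sup>2 - k * P\<^sup>2) * (b * G) - x * G\<^sup>2 * (2 * P * w)"
    by (simp add: algebra_simps power2_eq_square)
  moreover have "(4 * (k + 1) * \<bar>b\<bar> + 4 * x) * (P\<^sup>2 + w\<^sup>2)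
      = (2 * (k + 1) * (P\<^sup>2 + w\<^sup>2)) * (\<bar>b\<bar> * 2) + (x * 4) * (P\<^sup>2 + w\<^sup>2)"
    by (simp add: algebra_simps)
  ultimately show ?thesis
    using abs_triangle_ineq4[of "2 * (w\<^sup>2 - k * P\<^sup>2) * (b * G)" "x * G\<^sup>2 * (2 * P * w)"]
    by linarith
qed

text \<open>
  The only information at \<open>x = 0\<close> is \<open>b \<rightarrow> 0\<close>, without a rate, so the terms with \<open>b / x\<close> need not be
  integrable a priori. The rate is bootstrapped through the energy \<open>N = P\<^sup>2 + w\<^sup>2\<close> and \<open>b' = w\<close>.
  First, \<open>b\<close> is so small that \<open>x N\<close> increases; hence \<open>N = O(1 / x)\<close>, \<open>w = O(x\<^bsup>-1/2\<^esup>)\<close> and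
  \<open>b = O(x\<^bsup>1/2\<^esup>)\<close>. Now \<open>b / x\<close> is integrable, and a second Gronwall argument bounds \<open>N\<close>. Then
  \<open>b = O(x)\<close>, so \<open>P'\<close> and \<open>w'\<close> are bounded, and \<open>P\<close> and \<open>w\<close> have limits at 0.
\<close>

lemma far_field_limits:
  fixes P w b :: "real \<Rightarrow> real"
  assumes k: "k \<ge> 0" and d: "d > 0"
    and b_lim: "(b \<longlongrightarrow> 0) (at_right 0)"
    and b': "\<And>x. 0 < x \<Longrightarrow> x < d \<Longrightarrow> (b has_real_derivative w x) (at x)"
    and P': "\<And>x. 0 < x \<Longrightarrow> x < d \<Longrightarrow>
      (P has_real_derivative - k * P x * b x / (1 - b x) / x) (at x)"
    and w': "\<And>x. 0 < x \<Longrightarrow> x < d \<Longrightarrow>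
      (w has_real_derivative w x * b x / (1 - b x) / x - P x / (1 - b x)\<^sup>2) (at x)"
  obtains e M P\<^sub>0 w\<^sub>0 where "0 < e" "e \<le> d"
    "\<And>x. 0 < x \<Longrightarrow> x < e \<Longrightarrow> \<bar>P x\<bar> \<le> M \<and> \<bar>w x\<bar> \<le> M \<and> \<bar>b x\<bar> \<le> M * x \<and> \<bar>b x\<bar> \<le> 1 / 2"
    "(P \<longlongrightarrow> P\<^sub>0) (at_right 0)" "(w \<longlongrightarrow> w\<^sub>0) (at_right 0)"
proof -
  \<comment> \<open>With \<open>\<bar>b\<bar> < \<epsilon>\<close> and \<open>x < 1 / 8\<close> the energy estimate reads \<open>\<bar>x N'\<bar> \<le> N\<close>, which makes \<open>x N\<close> increase.\<close>
  define \<epsilon> where "\<epsilon> = min (1 / 2) (1 / (8 * (k + 1)))"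
  have \<epsilon>: "\<epsilon> > 0" "\<epsilon> \<le> 1 / 2" "\<epsilon> \<le> 1 / (8 * (k + 1))"
    using k by (auto simp: \<epsilon>_def)
  have "\<forall>\<^sub>F x in at_right 0. \<bar>b x\<bar> < \<epsilon>"
    using tendstoD[OF b_lim \<epsilon>(1)] by (simp add: dist_real_def)
  then obtain d\<^sub>1 where d\<^sub>1: "d\<^sub>1 > 0" "\<And>x. 0 < x \<Longrightarrow> x < d\<^sub>1 \<Longrightarrow> \<bar>b x\<bar> < \<epsilon>"
    by (auto simp: eventually_at_right_field)
  define e where "e = min (min d d\<^sub>1) (1 / 8)"
  have e: "0 < e" "e \<le> d" "e \<le> d\<^sub>1" "e \<le> 1 / 8" using d d\<^sub>1 by (auto simp: e_def)
  have b_small: "\<bar>b x\<bar> \<le> 1 / 2" "4 * (k + 1) * \<bar>b x\<bar> \<le> 1 / 2" if "0 < x" "x < e" for x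
  proof -
    have *: "\<bar>b x\<bar> \<le> \<epsilon>" using d\<^sub>1 that e by (meson less_imp_le less_le_trans)
    then show "\<bar>b x\<bar> \<le> 1 / 2" using \<epsilon> by linarith
    have "4 * (k + 1) * \<bar>b x\<bar> \<le> 4 * (k + 1) * (1 / (8 * (k + 1)))"
      using * \<epsilon> k by (intro mult_left_mono) auto
    also have "\<dots> = 1 / 2" using k by (simp add: field_simps)
    finally show "4 * (k + 1) * \<bar>b x\<bar> \<le> 1 / 2" .
  qed
  define G where "G = (\<lambda>x. 1 / (1 - b x))"
  have G: "\<bar>G x\<bar> \<le> 2" if "0 < x" "x < e" for x
    using b_small(1)[OF that] by (auto simp: G_def divide_le_eq abs_le_iff)
  define N where "N = (\<lambda>x. (P x)\<^sup>2 + (w x)\<^sup>2)"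
  define N' where "N' = (\<lambda>x. (2 * P x * (- k * P x * b x * G x)
    + 2 * w x * (w x * b x * G x - x * P x * (G x)\<^sup>2)) / x)"
  have N': "(N has_real_derivative N' x) (at x)" if "0 < x" "x < e" for x
  proof -
    have deriv: "(N has_real_derivative 2 * P x * (- k * P x * b x / (1 - b x) / x)
        + 2 * w x * (w x * b x / (1 - b x) / x - P x / (1 - b x)\<^sup>2)) (at x)"
      unfolding N_def using that e
      by (auto intro!: derivative_eq_intros P' w' simp: power2_eq_square mult_ac)
    have "y / (1 - b x) = y * G x" "y / (1 - b x)\<^sup>2 = y * (G x)\<^sup>2" for y
      by (simp_all add: G_def power_divide)
    then have "2 * P x * (- k * P x * b x / (1 - b x) / x)
        + 2 * w x * (w x * b x / (1 - b x) / x - P x / (1 - b x)\<^sup>2) = N' x"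
      using that unfolding N'_def by (simp only:) (simp add: field_simps)
    with deriv show ?thesis by simp
  qed
  have N'_bound: "\<bar>N' x\<bar> \<le> (4 * (k + 1) * \<bar>b x\<bar> + 4 * x) * N x / x" if "0 < x" "x < e" for x
    using far_field_energy_deriv[OF k _ G[OF that], of x "P x" "b x" "w x"] that
    unfolding N'_def N_def by (simp add: divide_right_mono)
  have N_nonneg: "N x \<ge> 0" for x by (simp add: N_def)

  define x\<^sub>1 where "x\<^sub>1 = e / 2"
  have x\<^sub>1: "0 < x\<^sub>1" "x\<^sub>1 < e" using e by (auto simp: x\<^sub>1_def)
  define C where "C = sqrt (x\<^sub>1 * N x\<^sub>1) + 1"
  have C: "C > 0" using x\<^sub>1 N_nonneg by (simp add: C_def add_nonneg_pos)
  have step1: "x * N x \<le> C\<^sup>2" if x: "0 < x" "x \<le> x\<^sub>1" for x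
  proof -
    have "x * N x \<le> x\<^sub>1 * N x\<^sub>1"
    proof (rule DERIV_nonneg_imp_nondecreasing[of x x\<^sub>1 "\<lambda>x. x * N x"])
      fix z assume z: "x \<le> z" "z \<le> x\<^sub>1"
      then have z': "0 < z" "z < e" using x x\<^sub>1 by auto
      have "((\<lambda>x. x * N x) has_real_derivative N z + z * N' z) (at z)"
        using N'[OF z'] by (auto intro!: derivative_eq_intros)
      moreover have "\<bar>N' z\<bar> \<le> 1 * N z / z"
        using b_small(2)[OF z'] z' e N_nonneg
        by (intro order_trans[OF N'_bound[OF z']] divide_right_mono mult_right_mono) auto
      then have "N z + z * N' z \<ge> 0"
        using z' by (simp add: abs_le_iff field_simps)
      ultimately show "\<exists>y. ((\<lambda>x. x * N x) has_real_derivative y) (at z) \<and> 0 \<le> y" by blast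
    qed (use x in auto)
    also have "\<dots> = (sqrt (x\<^sub>1 * N x\<^sub>1))\<^sup>2" using x\<^sub>1 N_nonneg by simp
    also have "\<dots> \<le> C\<^sup>2" unfolding C_def using x\<^sub>1 N_nonneg by (intro power_mono) auto
    finally show ?thesis .
  qed
  have w_sqrt: "\<bar>w x\<bar> \<le> C / sqrt x" if x: "0 < x" "x \<le> x\<^sub>1" for x
  proof -
    have "(\<bar>w x\<bar> * sqrt x)\<^sup>2 \<le> x * N x"
      using x by (simp add: power_mult_distrib N_def distrib_left)
    also have "\<dots> \<le> C\<^sup>2" by (rule step1[OF x])
    finally have "\<bar>w x\<bar> * sqrt x \<le> C" by (rule power2_le_imp_le) (use C in simp)
    then show ?thesis using x by (simp add: pos_le_divide_eq)
  qed
  have b_sqrt: "\<bar>b x\<bar> \<le> 2 * C * sqrt x" if x: "0 < x" "x < x\<^sub>1" for x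
  proof (rule abs_le_if_abs_deriv_le_from_0[where f = b and f' = w and h = "\<lambda>x. 2 * C * sqrt x"
        and h' = "\<lambda>x. C / sqrt x", OF _ _ _ b_lim _ x])
    show "(b has_real_derivative w z) (at z)" if "0 < z" "z < x\<^sub>1" for z
      using that x\<^sub>1 e by (intro b') auto
    show "((\<lambda>x. 2 * C * sqrt x) has_real_derivative C / sqrt z) (at z)" if "0 < z" for z
      using that by (auto intro!: derivative_eq_intros simp: field_simps)
    show "\<bar>w z\<bar> \<le> C / sqrt z" if "0 < z" "z < x\<^sub>1" for z
      using that by (intro w_sqrt) auto
    have "((\<lambda>x. 2 * C * sqrt x) \<longlongrightarrow> 2 * C * sqrt 0) (at_right 0)"
      by (intro tendsto_intros)
    then show "((\<lambda>x. 2 * C * sqrt x) \<longlongrightarrow> 0) (at_right 0)" by simp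
  qed

  \<comment> \<open>From \<open>\<bar>b\<bar> \<le> 2 C \<surd>x\<close> the energy estimate becomes \<open>\<bar>N'\<bar> \<le> (E / \<surd>x) N\<close>, with integrating factor \<open>exp (2 E \<surd>x)\<close>.\<close>
  define E where "E = 8 * (k + 1) * C + 4"
  have E: "E > 0" using C k by (simp add: E_def add_nonneg_pos)
  define x\<^sub>2 where "x\<^sub>2 = x\<^sub>1 / 2"
  have x\<^sub>2: "0 < x\<^sub>2" "x\<^sub>2 < x\<^sub>1" using x\<^sub>1 by (auto simp: x\<^sub>2_def)
  define M where "M = sqrt (N x\<^sub>2 * exp (2 * E * sqrt x\<^sub>2)) + 1"
  have M: "M > 0" using N_nonneg by (simp add: M_def add_nonneg_pos)
  have step2: "N x \<le> M\<^sup>2" if x: "0 < x" "x \<le> x\<^sub>2" for x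
  proof -
    have "N x * 1 \<le> N x * exp (2 * E * sqrt x)"
      using x E N_nonneg by (intro mult_left_mono) auto
    also have "\<dots> \<le> N x\<^sub>2 * exp (2 * E * sqrt x\<^sub>2)"
    proof (rule DERIV_nonneg_imp_nondecreasing[of x x\<^sub>2 "\<lambda>x. N x * exp (2 * E * sqrt x)"])
      fix z assume z: "x \<le> z" "z \<le> x\<^sub>2"
      then have z': "0 < z" "z < e" "z < x\<^sub>1" using x x\<^sub>1 x\<^sub>2 by auto
      have deriv: "((\<lambda>x. N x * exp (2 * E * sqrt x)) has_real_derivative
          (N' z + E / sqrt z * N z) * exp (2 * E * sqrt z)) (at z)"
        using N'[OF z'(1,2)] z' by (auto intro!: derivative_eq_intros simp: field_simps)
      have "\<bar>N' z\<bar> \<le> E * sqrt z * N z / z"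
      proof (intro order_trans[OF N'_bound[OF z'(1,2)]] divide_right_mono mult_right_mono N_nonneg)
        have "4 * (k + 1) * \<bar>b z\<bar> \<le> 4 * (k + 1) * (2 * C * sqrt z)"
          using b_sqrt[of z] z' k by (intro mult_left_mono) auto
        moreover have "z \<le> sqrt z"
          using z' e by (intro real_le_rsqrt) (simp add: power2_eq_square mult_left_le_one_le)
        ultimately show "4 * (k + 1) * \<bar>b z\<bar> + 4 * z \<le> E * sqrt z"
          by (simp add: E_def algebra_simps)
      qed (use z' in auto)
      also have "E * sqrt z * N z / z = E / sqrt z * N z"
      proof -
        have "sqrt z / z = 1 / sqrt z"
          using z' by (simp add: sqrt_divide_self_eq inverse_eq_divide)
        then have "E * N z * (sqrt z / z) = E * N z * (1 / sqrt z)" by (simp only:)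
        then show ?thesis by (simp add: mult_ac)
      qed
      finally have "0 \<le> (N' z + E / sqrt z * N z) * exp (2 * E * sqrt z)"
        by (simp add: abs_le_iff)
      with deriv show "\<exists>y. ((\<lambda>x. N x * exp (2 * E * sqrt x)) has_real_derivative y) (at z) \<and> 0 \<le> y"
        by blast
    qed (use x in auto)
    also have "\<dots> = (sqrt (N x\<^sub>2 * exp (2 * E * sqrt x\<^sub>2)))\<^sup>2" using N_nonneg by simp
    also have "\<dots> \<le> M\<^sup>2" unfolding M_def using N_nonneg by (intro power_mono) auto
    finally show ?thesis by simp
  qed
  have P_bd: "\<bar>P x\<bar> \<le> M" and w_bd: "\<bar>w x\<bar> \<le> M" if "0 < x" "x \<le> x\<^sub>2" for x
  proof -
    have "(P x)\<^sup>2 \<le> M\<^sup>2" "(w x)\<^sup>2 \<le> M\<^sup>2"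
      using step2[OF that] zero_le_power2[of "P x"] zero_le_power2[of "w x"]
      unfolding N_def by linarith+
    then show "\<bar>P x\<bar> \<le> M" "\<bar>w x\<bar> \<le> M"
      using M by (simp_all add: power2_le_iff_abs_le)
  qed
  have b_bd: "\<bar>b x\<bar> \<le> M * x" if x: "0 < x" "x < x\<^sub>2" for x
    by (rule abs_le_mult_if_abs_deriv_le_from_0[where f = b and f' = w, OF _ _ b_lim x])
       (use x\<^sub>1 x\<^sub>2 e w_bd in \<open>auto intro!: b'\<close>)
  have bG_bd: "\<bar>b x / (1 - b x) / x\<bar> \<le> M * 2" if x: "0 < x" "x < x\<^sub>2" for x
  proof -
    have "\<bar>b x / x\<bar> * \<bar>G x\<bar> \<le> M * 2"
      using b_bd[OF x] G[of x] x x\<^sub>1 x\<^sub>2 M by (intro mult_mono) (auto simp: abs_mult field_simps)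
    then show ?thesis by (simp add: G_def abs_mult mult_ac)
  qed
  obtain P\<^sub>0 where "(P \<longlongrightarrow> P\<^sub>0) (at_right 0)"
  proof (rule tendsto_at_right_0_if_deriv_bounded[OF x\<^sub>2(1)])
    fix x assume x: "0 < x" "x < x\<^sub>2"
    show "(P has_real_derivative - k * P x * (b x / (1 - b x) / x)) (at x)"
      using P'[of x] x x\<^sub>2 x\<^sub>1 e by simp
    show "\<bar>- k * P x * (b x / (1 - b x) / x)\<bar> \<le> k * M * (M * 2)"
      using bG_bd[OF x] P_bd[of x] x k M unfolding abs_mult
      by (intro mult_mono mult_nonneg_nonneg) auto
  qed
  moreover obtain w\<^sub>0 where "(w \<longlongrightarrow> w\<^sub>0) (at_right 0)"
  proof (rule tendsto_at_right_0_if_deriv_bounded[OF x\<^sub>2(1)])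
    fix x assume x: "0 < x" "x < x\<^sub>2"
    show "(w has_real_derivative w x * (b x / (1 - b x) / x) - P x * (G x * G x)) (at x)"
      using w'[of x] x x\<^sub>2 x\<^sub>1 e by (simp add: G_def power2_eq_square)
    have "\<bar>w x * (b x / (1 - b x) / x)\<bar> \<le> M * (M * 2)"
      using bG_bd[OF x] w_bd[of x] x M unfolding abs_mult[of "w x"] by (intro mult_mono) auto
    moreover have "\<bar>P x * (G x * G x)\<bar> \<le> M * (2 * 2)"
      using G[of x] P_bd[of x] x x\<^sub>1 x\<^sub>2 M unfolding abs_mult by (intro mult_mono) auto
    ultimately show "\<bar>w x * (b x / (1 - b x) / x) - P x * (G x * G x)\<bar> \<le> M * (M * 2) + M * (2 * 2)"
      by linarith
  qed
  moreover have "\<bar>P x\<bar> \<le> M \<and> \<bar>w x\<bar> \<le> M \<and> \<bar>b x\<bar> \<le> M * x \<and> \<bar>b x\<bar> \<le> 1 / 2" if "0 < x" "x < x\<^sub>2" for x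
    using P_bd w_bd b_bd b_small(1) that x\<^sub>1 x\<^sub>2 by simp
  ultimately show ?thesis
    using x\<^sub>1 x\<^sub>2 e by (intro that[of x\<^sub>2]) auto
qed

section \<open>Sums of the series as solutions of the far-field system\<close>

text \<open>
  The second conclusion lets the first be applied to iterated products.
\<close>

lemma eval_fps_mult_in_radius:
  fixes F G :: "real fps"
  assumes "ereal (norm x) < fps_conv_radius F" "ereal (norm x) < fps_conv_radius G"
  shows "eval_fps (F * G) x = eval_fps F x * eval_fps G x" "ereal (norm x) < fps_conv_radius (F * G)"
  using assms less_le_trans[OF _ fps_conv_radius_mult, of "ereal (norm x)" F G]
  by (simp_all add: eval_fps_mult)

lemma far_field_series_solution:
  fixes P w a G :: "real fps"
  assumes eqs: "fps_deriv P = fps_const (- k) * (P * a * G)"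
    "fps_deriv w = w * a * G - P * G * G"
    "fps_deriv G = w * G * G" "fps_deriv (fps_X * a) = w"
    and rad: "fps_conv_radius P > 0" "fps_conv_radius w > 0" "fps_conv_radius a > 0" "fps_conv_radius G > 0"
  obtains e M where "e > 0"
    "far_field_solution k e (eval_fps P) (eval_fps w) (eval_fps a) (eval_fps G)"
    "\<And>x F. 0 < x \<Longrightarrow> x < e \<Longrightarrow> F \<in> {P, w, a, G} \<Longrightarrow> \<bar>eval_fps F x\<bar> \<le> M"
    "\<And>x F. 0 < x \<Longrightarrow> x < e \<Longrightarrow> F \<in> {P, w, a, G} \<Longrightarrow> ereal (norm x) < fps_conv_radius F"
proof -
  define R where "R = Min (fps_conv_radius ` {P, w, a, G})"
  have "R > 0" using rad unfolding R_def by (subst Min_gr_iff) auto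
  then obtain e where e: "0 < ereal e" "ereal e < R"
    using ereal_dense2 by blast
  have e_pos: "e > 0" using e by simp
  have inside: "ereal (norm x) < fps_conv_radius F" if "0 \<le> x" "x \<le> e" "F \<in> {P, w, a, G}" for x F
  proof -
    have "R \<le> fps_conv_radius F" using that unfolding R_def by (intro Min_le) auto
    moreover have "ereal (norm x) \<le> ereal e" using that by simp
    ultimately show ?thesis using e(2) by order
  qed
  have sol: "far_field_solution k e (eval_fps P) (eval_fps w) (eval_fps a) (eval_fps G)"
    unfolding far_field_solution_def
  proof (intro allI impI conjI)
    fix x assume x: "0 < x" "x < e"
    have i: "ereal (norm x) < fps_conv_radius P" "ereal (norm x) < fps_conv_radius w"
      "ereal (norm x) < fps_conv_radius a" "ereal (norm x) < fps_conv_radius G"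
      using x inside[of x P] inside[of x w] inside[of x a] inside[of x G] by simp_all
    have c: "ereal (norm x) < fps_conv_radius (fps_const (- k))" by simp
    note m = eval_fps_mult_in_radius eval_fps_diff i c
    show "(eval_fps P has_real_derivative - k * (eval_fps P x * eval_fps a x * eval_fps G x)) (at x)"
      using has_field_derivative_eval_fps[OF i(1), of UNIV] unfolding eqs(1) by (simp add: m del: fps_const_neg real_norm_def)
    show "(eval_fps w has_real_derivative
        eval_fps w x * eval_fps a x * eval_fps G x - eval_fps P x * eval_fps G x * eval_fps G x) (at x)"
      using has_field_derivative_eval_fps[OF i(2), of UNIV] unfolding eqs(2) by (simp add: m del: real_norm_def)
    show "(eval_fps G has_real_derivative eval_fps w x * eval_fps G x * eval_fps G x) (at x)"
      using has_field_derivative_eval_fps[OF i(4), of UNIV] unfolding eqs(3) by (simp add: m del: real_norm_def)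
    have "(eval_fps a has_real_derivative eval_fps (fps_deriv a) x) (at x)"
      by (intro has_field_derivative_eval_fps i)
    then have "((\<lambda>x. x * eval_fps a x) has_real_derivative x * eval_fps (fps_deriv a) x + eval_fps a x) (at x)"
      by (auto intro!: derivative_eq_intros)
    also have "x * eval_fps (fps_deriv a) x + eval_fps a x = eval_fps (fps_deriv (fps_X * a)) x"
    proof -
      have "ereal (norm x) < fps_conv_radius (fps_deriv a)"
        using i(3) fps_conv_radius_deriv[of a] by order
      moreover have "ereal (norm x) < fps_conv_radius (fps_X * fps_deriv a)"
        using calculation by (intro eval_fps_mult_in_radius) auto
      ultimately show ?thesis using i(3) by (simp add: eval_fps_mult_in_radius eval_fps_add del: real_norm_def)
    qed
    finally show "((\<lambda>x. x * eval_fps a x) has_real_derivative eval_fps w x) (at x)"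
      unfolding eqs(4) .
  qed
  have "bounded (\<Union>F\<in>{P, w, a, G}. eval_fps F ` {0..e})"
  proof (rule bounded_UN)
    show "\<forall>F\<in>{P, w, a, G}. bounded (eval_fps F ` {0..e})"
    proof
      fix F assume "F \<in> {P, w, a, G}"
      then have "{0..e} \<subseteq> eball 0 (fps_conv_radius F)"
        using inside[of _ F] by (auto simp: in_eball_iff)
      then show "bounded (eval_fps F ` {0..e})"
        by (intro compact_imp_bounded compact_continuous_image compact_Icc
              continuous_on_subset[OF continuous_on_eval_fps])
    qed
  qed simp
  then obtain M where "\<forall>y\<in>(\<Union>F\<in>{P, w, a, G}. eval_fps F ` {0..e}). norm y \<le> M"
    unfolding bounded_iff by blast
  then have "\<bar>eval_fps F x\<bar> \<le> M" if "0 < x" "x < e" "F \<in> {P, w, a, G}" for x F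
    using that by force
  then show ?thesis
    by (rule that[OF e_pos sol]) (auto intro: inside simp del: real_norm_def)
qed

section \<open>The local system in the far-field variable\<close>

lemma filterlim_powr_minus_at_right_0:
  assumes "(c::real) > 0"
  shows "filterlim (\<lambda>x::real. x powr (- c)) at_top (at_right 0)"
proof (rule filterlim_cong[OF refl refl, THEN iffD1])
  have "filterlim (\<lambda>x::real. c * - ln x) at_top (at_right 0)"
    using assms ln_at_0
    by (intro filterlim_tendsto_pos_mult_at_top[OF tendsto_const]) (auto simp: filterlim_uminus_at_top)
  then show "filterlim (\<lambda>x::real. exp (c * - ln x)) at_top (at_right 0)"
    by (rule filterlim_compose[OF exp_at_top])
  show "\<forall>\<^sub>F x in at_right 0. exp (c * - ln x) = x powr (- c)"
    using eventually_at_right_less[of "0::real"] by eventually_elim (simp add: powr_def)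
qed

text \<open>
  Since \<open>x d/dx = - c \<xi> d/d\<xi>\<close>, the relation \<open>(U / \<xi>)' = W / \<xi>\<close> becomes \<open>b' = w\<close>. The first two
  equations of the local system give \<open>\<rho>'\<close> and \<open>W'\<close> after division by \<open>c \<xi> + U = c \<xi> (1 - b)\<close>,
  which is nonzero exactly when \<open>b \<noteq> 1\<close>.
\<close>

lemma far_field_system:
  fixes c x :: real and \<rho> U W :: "real \<Rightarrow> real"
  defines "\<xi> \<equiv> \<lambda>x. x powr (- c)"
  defines "P \<equiv> \<lambda>x. (c - 2) / c * (\<rho> (\<xi> x) / \<xi> x) / x\<^sup>2"
    and "w \<equiv> \<lambda>x. W (\<xi> x) / x" and "b \<equiv> \<lambda>x. - (U (\<xi> x) / \<xi> x) / c"
  assumes c: "c > 2" and x: "x > 0" and sys: "local_system c \<rho> U W (\<xi> x)" and b: "b x \<noteq> 1"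
  shows "(b has_real_derivative w x) (at x)"
    "(P has_real_derivative - (c - 2) * P x * b x / (1 - b x) / x) (at x)"
    "(w has_real_derivative w x * b x / (1 - b x) / x - P x / (1 - b x)\<^sup>2) (at x)"
proof -
  have \<xi>_pos: "\<xi> x > 0" using x by (simp add: \<xi>_def)
  have \<xi>': "(\<xi> has_real_derivative - c * \<xi> x / x) (at x)"
    unfolding \<xi>_def using x by (auto intro!: derivative_eq_intros simp: powr_diff)
  \<comment> \<open>Everything is expressed through \<open>\<beta>\<close>, the only denominator besides \<open>x\<close>, \<open>\<xi>\<close> and \<open>c\<close>.\<close>
  define \<beta> where "\<beta> = 1 - b x"
  have \<beta>: "\<beta> \<noteq> 0" using b by (simp add: \<beta>_def)
  have U: "U (\<xi> x) = - c * (1 - \<beta>) * \<xi> x" using \<xi>_pos c by (simp add: \<beta>_def b_def)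
  define r v where "r = deriv \<rho> (\<xi> x)" and "v = deriv W (\<xi> x)"
  have \<rho>': "(\<rho> has_real_derivative r) (at (\<xi> x))" and W': "(W has_real_derivative v) (at (\<xi> x))"
    using sys by (simp_all add: local_system_def r_def v_def DERIV_deriv_iff_real_differentiable)
  have "(2 - c) * \<rho> (\<xi> x) + c * \<xi> x * r + U (\<xi> x) * r = 0"
    "W (\<xi> x) + c * \<xi> x * v + U (\<xi> x) * v - r = 0"
    using sys by (simp_all add: local_system_def r_def v_def)
  then have "c * \<beta> * \<xi> x * r = (c - 2) * \<rho> (\<xi> x)" "c * \<beta> * \<xi> x * v = r - W (\<xi> x)"
    unfolding U by (simp_all add: algebra_simps)
  then have r: "r = (c - 2) * \<rho> (\<xi> x) / (c * \<beta> * \<xi> x)" and v: "v = (r - W (\<xi> x)) / (c * \<beta> * \<xi> x)"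
    using c \<beta> \<xi>_pos by (simp_all add: eq_divide_eq mult_ac)

  have "(\<lambda>y. U y / y) differentiable (at (\<xi> x))"
    using sys \<xi>_pos by (auto simp: local_system_def intro!: derivative_intros)
  then have "((\<lambda>y. U y / y) has_real_derivative W (\<xi> x) / \<xi> x) (at (\<xi> x))"
    using sys by (simp add: local_system_def flip: DERIV_deriv_iff_real_differentiable)
  from DERIV_cdivide[OF DERIV_minus[OF DERIV_chain2[OF this \<xi>']], of c]
  show "(b has_real_derivative w x) (at x)"
    unfolding b_def w_def using c \<xi>_pos x by simp

  have "((\<lambda>x. \<rho> (\<xi> x)) has_real_derivative r * (- c * \<xi> x / x)) (at x)"
    by (rule DERIV_chain2[OF \<rho>' \<xi>'])
  from DERIV_divide[OF this \<xi>' less_imp_neq[OF \<xi>_pos, symmetric]] have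
    "((\<lambda>x. \<rho> (\<xi> x) / \<xi> x) has_real_derivative c * (\<rho> (\<xi> x) / \<xi> x - r) / x) (at x)"
    using \<xi>_pos x by (elim DERIV_cong) (simp add: field_simps)
  from DERIV_divide[OF DERIV_cmult[OF this, of "(c - 2) / c"] DERIV_power[OF DERIV_ident, of 2]] x
  have "(P has_real_derivative ((c - 2) / c * (c * (\<rho> (\<xi> x) / \<xi> x - r) / x) * x\<^sup>2
      - (c - 2) / c * (\<rho> (\<xi> x) / \<xi> x) * (2 * x)) / (x\<^sup>2 * x\<^sup>2)) (at x)"
    unfolding P_def by simp
  then show "(P has_real_derivative - (c - 2) * P x * b x / (1 - b x) / x) (at x)"
  proof (rule DERIV_cong)
    have "b x = 1 - \<beta>" by (simp add: \<beta>_def)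
    then show "((c - 2) / c * (c * (\<rho> (\<xi> x) / \<xi> x - r) / x) * x\<^sup>2
        - (c - 2) / c * (\<rho> (\<xi> x) / \<xi> x) * (2 * x)) / (x\<^sup>2 * x\<^sup>2)
      = - (c - 2) * P x * b x / (1 - b x) / x"
      unfolding r P_def using x \<xi>_pos c \<beta>
      by (simp add: divide_simps power2_eq_square) (simp add: algebra_simps)
  qed

  have "((\<lambda>x. W (\<xi> x)) has_real_derivative v * (- c * \<xi> x / x)) (at x)"
    by (rule DERIV_chain2[OF W' \<xi>'])
  from DERIV_divide[OF this DERIV_ident] x
  have "(w has_real_derivative (v * (- c * \<xi> x / x) * x - W (\<xi> x)) / (x * x)) (at x)"
    unfolding w_def by simp
  then show "(w has_real_derivative w x * b x / (1 - b x) / x - P x / (1 - b x)\<^sup>2) (at x)"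
  proof (rule DERIV_cong)
    have "b x = 1 - \<beta>" by (simp add: \<beta>_def)
    then show "(v * (- c * \<xi> x / x) * x - W (\<xi> x)) / (x * x)
      = w x * b x / (1 - b x) / x - P x / (1 - b x)\<^sup>2"
      unfolding v r P_def w_def using x \<xi>_pos c \<beta>
      by (simp add: divide_simps power2_eq_square) (simp add: algebra_simps)
  qed
qed

section \<open>Analyticity of the profile\<close>

text \<open>
  The limits of \<open>P\<close> and \<open>w\<close> at 0 are taken as initial values for the convergent series solution.
  The profile and the series then solve the same system, are bounded, and agree in the limit, so
  they coincide near 0. Undoing the substitution only multiplies the series by constants and powers
  of \<open>x\<close>.
\<close>

theorem far_field_analytic:
  fixes c :: real and \<rho> U W :: "real \<Rightarrow> real"
  defines "\<xi> \<equiv> \<lambda>x. x powr (- c)"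
  assumes c: "c > 2" and sys: "\<And>y. y > 0 \<Longrightarrow> local_system c \<rho> U W y"
    and lim: "((\<lambda>y. U y / y) \<longlongrightarrow> 0) at_top"
  shows "analytic_at_0_within (\<lambda>x. W (\<xi> x)) {0<..}"
    "analytic_at_0_within (\<lambda>x. U (\<xi> x) / \<xi> x) {0<..}"
    "analytic_at_0_within (\<lambda>x. \<rho> (\<xi> x) / \<xi> x) {0<..}"
proof -
  define P where "P = (\<lambda>x. (c - 2) / c * (\<rho> (\<xi> x) / \<xi> x) / x\<^sup>2)"
  define w where "w = (\<lambda>x. W (\<xi> x) / x)"
  define b where "b = (\<lambda>x. - (U (\<xi> x) / \<xi> x) / c)"
  have "filterlim \<xi> at_top (at_right 0)"
    unfolding \<xi>_def using c by (intro filterlim_powr_minus_at_right_0) auto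
  from filterlim_compose[OF lim this] have "((\<lambda>x. - (U (\<xi> x) / \<xi> x) / c) \<longlongrightarrow> - 0 / c) (at_right 0)"
    using c by (intro tendsto_divide tendsto_minus tendsto_const) auto
  then have b_lim: "(b \<longlongrightarrow> 0) (at_right 0)" by (simp add: b_def)
  have "\<forall>\<^sub>F x in at_right 0. b x < 1"
    using b_lim by (rule order_tendstoD) simp
  then obtain d where d: "d > 0" "\<And>x. 0 < x \<Longrightarrow> x < d \<Longrightarrow> b x < 1"
    by (auto simp: eventually_at_right_field)
  have ode: "(b has_real_derivative w x) (at x)"
    "(P has_real_derivative - (c - 2) * P x * b x / (1 - b x) / x) (at x)"
    "(w has_real_derivative w x * b x / (1 - b x) / x - P x / (1 - b x)\<^sup>2) (at x)"
    if "0 < x" "x < d" for x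
    using far_field_system[OF c that(1), of \<rho> U W] sys[of "\<xi> x"] d(2)[OF that] that(1)
    unfolding P_def w_def b_def \<xi>_def by auto
  obtain e\<^sub>1 M\<^sub>1 P\<^sub>0 w\<^sub>0 where e\<^sub>1: "0 < e\<^sub>1" "e\<^sub>1 \<le> d"
    and bd: "\<And>x. 0 < x \<Longrightarrow> x < e\<^sub>1 \<Longrightarrow> \<bar>P x\<bar> \<le> M\<^sub>1 \<and> \<bar>w x\<bar> \<le> M\<^sub>1 \<and> \<bar>b x\<bar> \<le> M\<^sub>1 * x \<and> \<bar>b x\<bar> \<le> 1 / 2"
    and P_lim: "(P \<longlongrightarrow> P\<^sub>0) (at_right 0)" and w_lim: "(w \<longlongrightarrow> w\<^sub>0) (at_right 0)"
    by (rule far_field_limits[of "c - 2" d b w P]) (use c d b_lim ode in auto)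
  define a where "a = (\<lambda>x. b x / x)"
  define G where "G = (\<lambda>x. 1 / (1 - b x))"
  have sol: "far_field_solution (c - 2) e\<^sub>1 P w a G"
    unfolding far_field_solution_def
  proof (intro allI impI conjI)
    fix x assume x: "0 < x" "x < e\<^sub>1"
    then have ode_x: "(b has_real_derivative w x) (at x)"
      "(P has_real_derivative - (c - 2) * P x * b x / (1 - b x) / x) (at x)"
      "(w has_real_derivative w x * b x / (1 - b x) / x - P x / (1 - b x)\<^sup>2) (at x)"
      and b1: "b x < 1"
      using ode[of x] d(2)[of x] e\<^sub>1 by auto
    show "(P has_real_derivative - (c - 2) * (P x * a x * G x)) (at x)"
      using ode_x(2) by (simp add: a_def G_def mult_ac)
    show "(w has_real_derivative w x * a x * G x - P x * G x * G x) (at x)"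
      using ode_x(3) by (simp add: a_def G_def power2_eq_square mult_ac)
    show "(G has_real_derivative w x * G x * G x) (at x)"
      unfolding G_def using ode_x(1) b1
      by (auto intro!: derivative_eq_intros simp: power2_eq_square)
    show "((\<lambda>x. x * a x) has_real_derivative w x) (at x)"
    proof (rule has_field_derivative_transform_within_open[OF ode_x(1), of "{0<..}"])
      show "b y = y * a y" if "y \<in> {0<..}" for y using that by (simp add: a_def)
    qed (use x in auto)
  qed
  obtain P\<^sub>s w\<^sub>s a\<^sub>s G\<^sub>s :: "real fps" where init: "P\<^sub>s $ 0 = P\<^sub>0" "w\<^sub>s $ 0 = w\<^sub>0" "G\<^sub>s $ 0 = 1"
    and eqs: "fps_deriv P\<^sub>s = fps_const (- (c - 2)) * (P\<^sub>s * a\<^sub>s * G\<^sub>s)"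
      "fps_deriv w\<^sub>s = w\<^sub>s * a\<^sub>s * G\<^sub>s - P\<^sub>s * G\<^sub>s * G\<^sub>s"
      "fps_deriv G\<^sub>s = w\<^sub>s * G\<^sub>s * G\<^sub>s" "fps_deriv (fps_X * a\<^sub>s) = w\<^sub>s"
    and rad: "fps_conv_radius P\<^sub>s > 0" "fps_conv_radius w\<^sub>s > 0" "fps_conv_radius a\<^sub>s > 0"
      "fps_conv_radius G\<^sub>s > 0"
    by (rule far_field_series_exists[of "c - 2" P\<^sub>0 w\<^sub>0]) (use c in simp)
  obtain e\<^sub>2 M\<^sub>2 where e\<^sub>2: "0 < e\<^sub>2"
    and sol_s: "far_field_solution (c - 2) e\<^sub>2 (eval_fps P\<^sub>s) (eval_fps w\<^sub>s) (eval_fps a\<^sub>s) (eval_fps G\<^sub>s)"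
    and bd_s: "\<And>x F. 0 < x \<Longrightarrow> x < e\<^sub>2 \<Longrightarrow> F \<in> {P\<^sub>s, w\<^sub>s, a\<^sub>s, G\<^sub>s} \<Longrightarrow> \<bar>eval_fps F x\<bar> \<le> M\<^sub>2"
    and in_s: "\<And>x F. 0 < x \<Longrightarrow> x < e\<^sub>2 \<Longrightarrow> F \<in> {P\<^sub>s, w\<^sub>s, a\<^sub>s, G\<^sub>s} \<Longrightarrow> ereal (norm x) < fps_conv_radius F"
    by (rule far_field_series_solution[OF eqs rad]) blast
  define M where "M = max (max M\<^sub>1 2) M\<^sub>2"
  define d' where "d' = min e\<^sub>1 e\<^sub>2"
  have d': "d' > 0" using e\<^sub>1 e\<^sub>2 by (simp add: d'_def)
  have lim_s: "(eval_fps F \<longlongrightarrow> F $ 0) (at_right 0)" if "fps_conv_radius F > 0" for F :: "real fps"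
    using continuous_eval_fps[of 0 F "{0<..}"] that
    by (simp add: continuous_within eval_fps_at_0 zero_ereal_def)
  have id_lim: "((\<lambda>x::real. x) \<longlongrightarrow> 0) (at_right 0)" by (rule tendsto_ident_at)
  obtain e where e: "e > 0" and eq: "\<And>x. 0 < x \<Longrightarrow> x < e \<Longrightarrow> P x = eval_fps P\<^sub>s x \<and>
      w x = eval_fps w\<^sub>s x \<and> a x = eval_fps a\<^sub>s x \<and> G x = eval_fps G\<^sub>s x"
  proof (rule far_field_solution_unique[of "c - 2" d' P w a G "eval_fps P\<^sub>s" "eval_fps w\<^sub>s"
        "eval_fps a\<^sub>s" "eval_fps G\<^sub>s" M])
    show "far_field_solution (c - 2) d' P w a G"
      "far_field_solution (c - 2) d' (eval_fps P\<^sub>s) (eval_fps w\<^sub>s) (eval_fps a\<^sub>s) (eval_fps G\<^sub>s)"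
      using sol sol_s by (auto simp: far_field_solution_def d'_def)
    show "\<bar>f x\<bar> \<le> M" if x: "0 < x" "x < d'" and
      f: "f \<in> {P, w, a, G, eval_fps P\<^sub>s, eval_fps w\<^sub>s, eval_fps a\<^sub>s, eval_fps G\<^sub>s}" for x f
    proof -
      have "\<bar>P x\<bar> \<le> M\<^sub>1" "\<bar>w x\<bar> \<le> M\<^sub>1" "\<bar>b x\<bar> \<le> M\<^sub>1 * x" "\<bar>b x\<bar> \<le> 1 / 2"
        using bd[of x] x by (auto simp: d'_def)
      moreover from this have "\<bar>a x\<bar> \<le> M\<^sub>1" "\<bar>G x\<bar> \<le> 2"
        using x by (auto simp: a_def G_def divide_le_eq abs_le_iff)
      moreover have "\<bar>eval_fps P\<^sub>s x\<bar> \<le> M\<^sub>2" "\<bar>eval_fps w\<^sub>s x\<bar> \<le> M\<^sub>2" "\<bar>eval_fps a\<^sub>s x\<bar> \<le> M\<^sub>2"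
        "\<bar>eval_fps G\<^sub>s x\<bar> \<le> M\<^sub>2"
        using x by (auto simp: d'_def intro!: bd_s)
      moreover have "M\<^sub>1 \<le> M" "2 \<le> M" "M\<^sub>2 \<le> M" by (simp_all add: M_def)
      ultimately have "\<bar>P x\<bar> \<le> M" "\<bar>w x\<bar> \<le> M" "\<bar>a x\<bar> \<le> M" "\<bar>G x\<bar> \<le> M"
        "\<bar>eval_fps P\<^sub>s x\<bar> \<le> M" "\<bar>eval_fps w\<^sub>s x\<bar> \<le> M" "\<bar>eval_fps a\<^sub>s x\<bar> \<le> M"
        "\<bar>eval_fps G\<^sub>s x\<bar> \<le> M"
        by linarith+
      with f show ?thesis by (elim insertE emptyE) simp_all
    qed
    show "((\<lambda>x. P x - eval_fps P\<^sub>s x) \<longlongrightarrow> 0) (at_right 0)"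
      using tendsto_diff[OF P_lim lim_s[OF rad(1)]] init by simp
    show "((\<lambda>x. w x - eval_fps w\<^sub>s x) \<longlongrightarrow> 0) (at_right 0)"
      using tendsto_diff[OF w_lim lim_s[OF rad(2)]] init by simp
    have "((\<lambda>x. 1 / (1 - b x) - eval_fps G\<^sub>s x) \<longlongrightarrow> 1 / (1 - 0) - 1) (at_right 0)"
      using lim_s[OF rad(4)] init by (intro tendsto_intros b_lim) auto
    then show "((\<lambda>x. G x - eval_fps G\<^sub>s x) \<longlongrightarrow> 0) (at_right 0)" by (simp add: G_def)
    have "((\<lambda>x. b x - x * eval_fps a\<^sub>s x) \<longlongrightarrow> 0 - 0 * a\<^sub>s $ 0) (at_right 0)"
      by (intro tendsto_diff tendsto_mult b_lim id_lim lim_s rad)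
    moreover have "\<forall>\<^sub>F x in at_right 0. b x - x * eval_fps a\<^sub>s x = x * a x - x * eval_fps a\<^sub>s x"
      using eventually_at_right_less[of "0::real"] by eventually_elim (simp add: a_def)
    ultimately show "((\<lambda>x. x * a x - x * eval_fps a\<^sub>s x) \<longlongrightarrow> 0) (at_right 0)"
      using tendsto_cong by fastforce
  qed (use c d' in auto)
  have analytic: "analytic_at_0_within f {0<..}"
    if "fps_conv_radius F > 0" and "\<And>x. 0 < x \<Longrightarrow> x < min e e\<^sub>2 \<Longrightarrow> eval_fps F x = f x" for f F
  proof -
    have "\<forall>\<^sub>F x in nhds 0. x < min e e\<^sub>2"
      using eventually_nhds_in_open[of "{..<min e e\<^sub>2}" 0] e e\<^sub>2 by simp
    then have "\<forall>\<^sub>F x in nhds 0. x \<in> {0<..} \<longrightarrow> eval_fps F x = f x"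
      by eventually_elim (use that in auto)
    then show ?thesis using that(1)
      unfolding analytic_at_0_within_def has_fps_expansion_within_def by blast
  qed
  have rad_mult: "fps_conv_radius (F * H) > 0"
    if "fps_conv_radius F > 0" "fps_conv_radius H > 0" for F H :: "real fps"
    using less_le_trans[OF _ fps_conv_radius_mult, of 0 F H] that by simp
  show "analytic_at_0_within (\<lambda>x. W (\<xi> x)) {0<..}"
  proof (rule analytic)
    show "fps_conv_radius (fps_X * w\<^sub>s) > 0" by (intro rad_mult rad) simp
    show "eval_fps (fps_X * w\<^sub>s) x = W (\<xi> x)" if x: "0 < x" "x < min e e\<^sub>2" for x
    proof -
      have "eval_fps (fps_X * w\<^sub>s) x = x * eval_fps w\<^sub>s x"
        using in_s[of x w\<^sub>s] x by (simp add: eval_fps_mult_in_radius del: real_norm_def)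
      also have "\<dots> = x * w x" using eq[of x] x by simp
      finally show ?thesis using x by (simp add: w_def)
    qed
  qed
  show "analytic_at_0_within (\<lambda>x. U (\<xi> x) / \<xi> x) {0<..}"
  proof (rule analytic)
    show "fps_conv_radius (fps_const (- c) * (fps_X * a\<^sub>s)) > 0"
      by (intro rad_mult rad) (simp_all del: fps_const_neg)
    show "eval_fps (fps_const (- c) * (fps_X * a\<^sub>s)) x = U (\<xi> x) / \<xi> x"
      if x: "0 < x" "x < min e e\<^sub>2" for x
    proof -
      have "eval_fps (fps_const (- c) * (fps_X * a\<^sub>s)) x = - c * (x * eval_fps a\<^sub>s x)"
        using in_s[of x a\<^sub>s] x by (simp add: eval_fps_mult_in_radius del: fps_const_neg real_norm_def)
      also have "\<dots> = - c * (x * a x)" using eq[of x] x by simp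
      finally show ?thesis using x c by (simp add: a_def b_def)
    qed
  qed
  show "analytic_at_0_within (\<lambda>x. \<rho> (\<xi> x) / \<xi> x) {0<..}"
  proof (rule analytic)
    show "fps_conv_radius (fps_const (c / (c - 2)) * (fps_X * (fps_X * P\<^sub>s))) > 0"
      by (intro rad_mult rad) simp_all
    show "eval_fps (fps_const (c / (c - 2)) * (fps_X * (fps_X * P\<^sub>s))) x = \<rho> (\<xi> x) / \<xi> x"
      if x: "0 < x" "x < min e e\<^sub>2" for x
    proof -
      have "eval_fps (fps_const (c / (c - 2)) * (fps_X * (fps_X * P\<^sub>s))) x
          = c / (c - 2) * (x * (x * eval_fps P\<^sub>s x))"
        using in_s[of x P\<^sub>s] x by (simp add: eval_fps_mult_in_radius del: real_norm_def)
      also have "\<dots> = c / (c - 2) * (x * (x * P x))" using eq[of x] x by simp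
      finally show ?thesis using x c by (simp add: P_def power2_eq_square)
    qed
  qed
qed

theorem theorem1p2:
  fixes s :: nat and c\<^sub>l \<rho>\<^sub>s :: real and \<rho> U W :: "real \<Rightarrow> real"
  assumes "s \<ge> 2" and "c\<^sub>l > 2" and "\<rho>\<^sub>s > 0"
    and "constructed_profile s c\<^sub>l \<rho>\<^sub>s \<rho> U W"
    and "((\<lambda>\<xi>. U \<xi> / \<xi>) \<longlongrightarrow> 0) at_top"
  shows "(analytic_at_0_within W {0..} \<and>
          analytic_at_0_within U {0..} \<and>
          analytic_at_0_within \<rho> {0..}) \<and>
         (let \<xi> = (\<lambda>\<theta>::real. \<theta> powr (- c\<^sub>l)) in
          analytic_at_0_within (\<lambda>\<theta>. W (\<xi> \<theta>)) {0<..} \<and>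
          analytic_at_0_within (\<lambda>\<theta>. U (\<xi> \<theta>) / \<xi> \<theta>) {0<..} \<and>
          analytic_at_0_within (\<lambda>\<theta>. \<rho> (\<xi> \<theta>) / \<xi> \<theta>) {0<..})"
proof -
  have "local_system c\<^sub>l \<rho> U W y" if "y > 0" for y
    using assms(4) that by (simp add: constructed_profile_def)
  note far = far_field_analytic[OF assms(2) this assms(5)]
  have "analytic_at_0_within W {0..}" "analytic_at_0_within U {0..}" "analytic_at_0_within \<rho> {0..}"
    using assms(4) unfolding constructed_profile_def analytic_at_0_within_def by blast+
  with far show ?thesis by (simp add: Let_def)
qed

end
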